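(* Let $\pi : F_2 \rightarrow G$ be an epimorphism of the free group $F_2$ of rank $2$ onto a finite non-perfect group $G$ (i.e. $G \neq [G,G]$). Then the group $\Gamma^+(G,\pi)$ has infinite abelianization.
   Context: $F_2$ is the free group of rank $2$ and $F_2'$ its commutator subgroup. Let $\rho : \mathrm{Aut}(F_2) \rightarrow \mathrm{Aut}(F_2/F_2') \cong \mathrm{GL}_2(\mathbb{Z})$ be the natural homomorphism, and let $\mathrm{Aut}^+(F_2) := \rho^{-1}(\mathrm{SL}_2(\mathbb{Z}))$ be the special automorphism group. For an epimorphism $\pi : F_2 \rightarrow G$ onto a finite group $G$, set $$\Gamma^+(G,\pi) := \{ \varphi \in \mathrm{Aut}^+(F_2) \mid \pi \circ \varphi = \pi \}.$$ The abelianization of a group $H$ is $H/[H,H]$. *)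

theory Defs
  imports
    "HOL-Algebra.Bij"
    "HOL-Algebra.Generated_Groups"
    "HOL-Algebra.Elementary_Groups"
    "HOL-Analysis.Determinants"
begin

section \<open>Free groups\<close>

text \<open>The free group on a type of generators is realised by reduced words. The letter
  \<open>(i, True)\<close> stands for the generator \<open>i\<close>, and \<open>(i, False)\<close> for its inverse.\<close>

definition inv_letter :: "'a \<times> bool \<Rightarrow> 'a \<times> bool" where
  "inv_letter a = (fst a, \<not> snd a)"

definition reduced :: "('a \<times> bool) list \<Rightarrow> bool" where
  "reduced = successively (\<lambda>a b. b \<noteq> inv_letter a)"

fun push_letter :: "'a \<times> bool \<Rightarrow> ('a \<times> bool) list \<Rightarrow> ('a \<times> bool) list" where
  "push_letter a [] = [a]"
| "push_letter a (b # w) = (if b = inv_letter a then w else a # b # w)"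

definition free_group :: "('a \<times> bool) list monoid" where
  "free_group = \<lparr>carrier = {w. reduced w}, monoid.mult = (\<lambda>u v. foldr push_letter u v), one = []\<rparr>"

definition free_gen :: "'a \<Rightarrow> ('a \<times> bool) list" where
  "free_gen i = [(i, True)]"

text \<open>The two-element type \<open>2\<close> indexes the free basis, as it indexes \<open>2 \<times> 2\<close> matrices.\<close>

abbreviation F2 :: "(2 \<times> bool) list monoid" where
  "F2 \<equiv> free_group"


section \<open>Abelianization and the special automorphism group\<close>

definition abelianization :: "('a, 'b) monoid_scheme \<Rightarrow> 'a set monoid" where
  "abelianization G = G Mod (derived G (carrier G))"

definition ab_auto :: "('a, 'b) monoid_scheme \<Rightarrow> ('a \<Rightarrow> 'a) \<Rightarrow> 'a set \<Rightarrow> 'a set" where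
  "ab_auto G \<phi> = (\<lambda>C\<in>carrier (abelianization G). \<phi> ` C)"

definition ab_gen :: "2 \<Rightarrow> (2 \<times> bool) list set" where
  "ab_gen i = derived F2 (carrier F2) #>\<^bsub>F2\<^esub> free_gen i"

text \<open>The identification of the automorphisms of the abelianization of \<open>F2\<close> with integer matrices:
  column \<open>j\<close> holds the coordinates of the image of the \<open>j\<close>-th basis class. Existence and uniqueness
  of the matrix are proved in \<open>ab_matrix_ex1\<close> below.\<close>

definition is_ab_matrix :: "((2 \<times> bool) list set \<Rightarrow> (2 \<times> bool) list set) \<Rightarrow> int^2^2 \<Rightarrow> bool" where
  "is_ab_matrix \<alpha> M \<longleftrightarrow> (\<forall>j. \<alpha> (ab_gen j) =
     ab_gen 1 [^]\<^bsub>abelianization F2\<^esub> (M $ 1 $ j) \<otimes>\<^bsub>abelianization F2\<^esub>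
     ab_gen 2 [^]\<^bsub>abelianization F2\<^esub> (M $ 2 $ j))"

definition rho :: "((2 \<times> bool) list \<Rightarrow> (2 \<times> bool) list) \<Rightarrow> int^2^2" where
  "rho \<phi> = (THE M. is_ab_matrix (ab_auto F2 \<phi>) M)"

definition Aut_plus :: "((2 \<times> bool) list \<Rightarrow> (2 \<times> bool) list) set" where
  "Aut_plus = {\<phi> \<in> auto F2. det (rho \<phi>) = 1}"

text \<open>The target group of \<open>\<pi>\<close> does not enter, except through its carrier type.\<close>

definition Gamma_plus :: "((2 \<times> bool) list \<Rightarrow> 'g) \<Rightarrow> ((2 \<times> bool) list \<Rightarrow> (2 \<times> bool) list) set" where
  "Gamma_plus \<pi> = {\<phi> \<in> Aut_plus. \<forall>w\<in>carrier F2. \<pi> (\<phi> w) = \<pi> w}"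

definition Gamma_plus_group ::
    "((2 \<times> bool) list \<Rightarrow> 'g) \<Rightarrow> ((2 \<times> bool) list \<Rightarrow> (2 \<times> bool) list) monoid" where
  "Gamma_plus_group \<pi> = (AutoGroup F2)\<lparr>carrier := Gamma_plus \<pi>\<rparr>"


section \<open>The free group is a group with the expected universal property\<close>

lemma inv_letter_inv_letter [simp]: "inv_letter (inv_letter a) = a"
  by (simp add: inv_letter_def)

lemma reduced_Nil [simp]: "reduced []"
  by (simp add: reduced_def)

lemma reduced_Cons: "reduced (a # w) \<longleftrightarrow> reduced w \<and> (w = [] \<or> hd w \<noteq> inv_letter a)"
  by (auto simp: reduced_def successively_Cons)

lemma reduced_push: "reduced w \<Longrightarrow> reduced (push_letter a w)"
  by (cases w) (auto simp: reduced_Cons)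

lemma push_push_inv: "reduced w \<Longrightarrow> push_letter a (push_letter (inv_letter a) w) = w"
  by (cases w; cases "tl w") (auto simp: reduced_Cons)

lemma reduced_foldr: "reduced v \<Longrightarrow> reduced (foldr push_letter u v)"
  by (induction u) (auto simp: reduced_push)

lemma foldr_push_self: "reduced u \<Longrightarrow> foldr push_letter u [] = u"
proof (induction u)
  case (Cons a u)
  then show ?case by (cases u) (auto simp: reduced_Cons)
qed auto

lemma foldr_push_letter:
  "reduced w \<Longrightarrow> foldr push_letter (push_letter a v) w = push_letter a (foldr push_letter v w)"
  by (cases v) (auto simp: push_push_inv reduced_foldr)

lemma foldr_push_assoc:
  "reduced w \<Longrightarrow> foldr push_letter (foldr push_letter u v) w = foldr push_letter u (foldr push_letter v w)"
  by (induction u) (auto simp: foldr_push_letter)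

lemma free_group_inverse:
  "reduced w \<Longrightarrow> \<exists>v. reduced v \<and> foldr push_letter v w = []"
proof (induction w)
  case (Cons a w)
  then obtain v where v: "reduced v" "foldr push_letter v w = []" by (auto simp: reduced_Cons)
  have "foldr push_letter (foldr push_letter v [inv_letter a]) (a # w)
        = foldr push_letter v (foldr push_letter [inv_letter a] (a # w))"
    by (rule foldr_push_assoc) (use Cons in auto)
  also have "\<dots> = []" using v by simp
  finally show ?case using reduced_foldr[of "[inv_letter a]" v]
    by (auto simp: reduced_Cons)
qed (auto intro: exI[of _ "[]"])

lemma carrier_free_group: "w \<in> carrier free_group \<longleftrightarrow> reduced w"
  by (simp add: free_group_def)

lemma one_free_group: "\<one>\<^bsub>free_group\<^esub> = []"
  by (simp add: free_group_def)

lemma group_free_group: "group (free_group :: ('a \<times> bool) list monoid)"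
proof (rule groupI)
  fix x :: "('a \<times> bool) list" assume "x \<in> carrier free_group"
  then show "\<exists>y\<in>carrier free_group. y \<otimes>\<^bsub>free_group\<^esub> x = \<one>\<^bsub>free_group\<^esub>"
    using free_group_inverse[of x] by (auto simp: free_group_def)
qed (auto simp: free_group_def reduced_foldr foldr_push_assoc)

interpretation free: group free_group
  by (rule group_free_group)

lemma free_gen_closed [simp]: "free_gen i \<in> carrier free_group"
  by (simp add: free_gen_def carrier_free_group reduced_Cons)

lemma inv_free_gen: "inv\<^bsub>free_group\<^esub> (free_gen i) = [(i, False)]"
  by (rule free.inv_equality) (auto simp: free_group_def free_gen_def reduced_Cons inv_letter_def)

lemma free_group_Cons:
  assumes "reduced (a # w)"
  shows "a # w = (if snd a then free_gen (fst a) else inv\<^bsub>free_group\<^esub> (free_gen (fst a))) \<otimes>\<^bsub>free_group\<^esub> w"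
proof -
  have "push_letter a w = a # w"
    using assms by (cases w) (auto simp: reduced_Cons)
  then show ?thesis
    unfolding inv_free_gen by (cases a) (auto simp: free_gen_def free_group_def)
qed

lemma free_group_induct [consumes 1, case_names one gen inv_gen]:
  assumes "w \<in> carrier free_group" "P \<one>\<^bsub>free_group\<^esub>"
    "\<And>i w. w \<in> carrier free_group \<Longrightarrow> P w \<Longrightarrow> P (free_gen i \<otimes>\<^bsub>free_group\<^esub> w)"
    "\<And>i w. w \<in> carrier free_group \<Longrightarrow> P w \<Longrightarrow> P (inv\<^bsub>free_group\<^esub> (free_gen i) \<otimes>\<^bsub>free_group\<^esub> w)"
  shows "P w"
  using assms(1)
proof (induction w)
  case Nil
  then show ?case using assms(2) by (simp add: one_free_group)
next
  case (Cons a w)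
  then have r: "reduced (a # w)" "w \<in> carrier free_group" by (auto simp: carrier_free_group reduced_Cons)
  then show ?case
    using assms(3,4)[OF r(2)] Cons.IH free_group_Cons[OF r(1)] by (auto split: if_splits)
qed

definition free_lift :: "('g, 'm) monoid_scheme \<Rightarrow> ('a \<Rightarrow> 'g) \<Rightarrow> ('a \<times> bool) list \<Rightarrow> 'g" where
  "free_lift G f w = foldr (\<lambda>a x. (if snd a then f (fst a) else inv\<^bsub>G\<^esub> (f (fst a))) \<otimes>\<^bsub>G\<^esub> x) w \<one>\<^bsub>G\<^esub>"

context group
begin

lemma free_lift_closed: "range f \<subseteq> carrier G \<Longrightarrow> free_lift G f w \<in> carrier G"
  by (induction w) (auto simp: free_lift_def)

lemma free_lift_push:
  assumes "range f \<subseteq> carrier G"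
  shows "free_lift G f (push_letter a w) =
    (if snd a then f (fst a) else inv (f (fst a))) \<otimes> free_lift G f w"
proof (cases w)
  case (Cons b v)
  have f: "f i \<in> carrier G" for i using assms by auto
  have "free_lift G f v \<in> carrier G" by (rule free_lift_closed[OF assms])
  then show ?thesis
    using f Cons by (auto simp: free_lift_def inv_letter_def m_assoc[symmetric])
qed (simp add: free_lift_def)

lemma free_lift_hom:
  assumes "range f \<subseteq> carrier G"
  shows "free_lift G f \<in> hom free_group G"
proof (rule homI)
  fix u v
  have f: "f i \<in> carrier G" for i using assms by auto
  have "free_lift G f (foldr push_letter u v) = free_lift G f u \<otimes> free_lift G f v"
  proof (induction u)
    case Nil
    then show ?case using free_lift_closed[OF assms] by (simp add: free_lift_def)
  next
    case (Cons a u)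
    have *: "free_lift G f (a # u) = (if snd a then f (fst a) else inv (f (fst a))) \<otimes> free_lift G f u"
      by (simp add: free_lift_def)
    show ?case using f Cons free_lift_closed[OF assms]
      by (simp add: free_lift_push[OF assms] * m_assoc)
  qed
  then show "free_lift G f (u \<otimes>\<^bsub>free_group\<^esub> v) = free_lift G f u \<otimes> free_lift G f v"
    by (simp add: free_group_def)
qed (rule free_lift_closed[OF assms])

lemma free_lift_gen: "range f \<subseteq> carrier G \<Longrightarrow> free_lift G f (free_gen i) = f i"
  by (simp add: free_lift_def free_gen_def image_subset_iff)

lemma free_hom_unique:
  assumes "h \<in> hom free_group G" "k \<in> hom free_group G" "\<And>i. h (free_gen i) = k (free_gen i)"
    "w \<in> carrier free_group"
  shows "h w = k w"
proof -
  interpret h: group_hom free_group G h using assms by unfold_locales auto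
  interpret k: group_hom free_group G k using assms by unfold_locales auto
  show ?thesis using assms(4)
    by (induction w rule: free_group_induct) (auto simp: assms(3))
qed

end


section \<open>The matrix of an automorphism is well defined and multiplicative\<close>

definition exp_sum :: "2 \<Rightarrow> (2 \<times> bool) list \<Rightarrow> int" where
  "exp_sum i = free_lift integer_group (\<lambda>j. if j = i then 1 else 0)"

lemma exp_sum_hom: "exp_sum i \<in> hom F2 integer_group"
  unfolding exp_sum_def by (rule group.free_lift_hom) auto

interpretation exp_sum: group_hom F2 integer_group "exp_sum i" for i
  by (intro group_hom.intro group_hom_axioms.intro group_free_group group_integer_group exp_sum_hom)

lemma exp_sum_gen: "exp_sum i (free_gen j) = (if j = i then 1 else 0)"
  unfolding exp_sum_def by (subst group.free_lift_gen) auto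

lemma exp_sum_derived:
  assumes "w \<in> derived F2 (carrier F2)" shows "exp_sum i w = 0"
proof -
  have sub: "derived_set F2 (carrier F2) \<subseteq> carrier F2" by (rule free.derived_set_in_carrier) simp
  have "w \<in> generate F2 (derived_set F2 (carrier F2))" using assms by (simp add: derived_def)
  then show ?thesis
  proof (induction rule: generate.induct)
    case (eng h1 h2)
    then show ?case
      using free.generate_in_carrier[OF sub eng(1)] free.generate_in_carrier[OF sub eng(2)] by simp
  next
    case (inv h)
    then show ?case by auto
  next
    case (incl h)
    then show ?case by auto
  qed auto
qed

abbreviation ab_class :: "(2 \<times> bool) list \<Rightarrow> (2 \<times> bool) list set" where
  "ab_class w \<equiv> derived F2 (carrier F2) #>\<^bsub>F2\<^esub> w"

lemma normal_derived: "derived F2 (carrier F2) \<lhd> F2"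
  by (rule free.derived_self_is_normal)

interpretation abF: comm_group "abelianization F2"
  unfolding abelianization_def by (rule free.derived_quot_is_comm_group)

lemma ab_class_hom: "ab_class \<in> hom F2 (abelianization F2)"
  unfolding abelianization_def by (rule normal.r_coset_hom_Mod[OF normal_derived])

interpretation ab_class: group_hom F2 "abelianization F2" ab_class
  by unfold_locales (rule ab_class_hom)

lemma exp_sum_ab_class:
  assumes "ab_class u = ab_class v" "u \<in> carrier F2" "v \<in> carrier F2"
  shows "exp_sum i u = exp_sum i v"
proof -
  have sub: "subgroup (derived F2 (carrier F2)) F2" using normal_derived by (rule normal_imp_subgroup)
  have "u \<in> ab_class v" using free.rcos_self[OF assms(2) sub] assms(1) by simp
  then obtain d where d: "d \<in> derived F2 (carrier F2)" "u = d \<otimes>\<^bsub>F2\<^esub> v" by (auto simp: r_coset_def)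
  then have "d \<in> carrier F2" using subgroup.subset[OF sub] by auto
  then show ?thesis using d assms exp_sum_derived[OF d(1)] by simp
qed

lemma ab_gen_closed [simp]: "ab_gen i \<in> carrier (abelianization F2)"
  by (simp add: ab_gen_def)

lemma ab_class_coords:
  assumes "w \<in> carrier F2"
  shows "ab_class w = ab_gen 1 [^]\<^bsub>abelianization F2\<^esub> (exp_sum 1 w) \<otimes>\<^bsub>abelianization F2\<^esub>
     ab_gen 2 [^]\<^bsub>abelianization F2\<^esub> (exp_sum 2 w)"
proof -
  let ?A = "abelianization F2"
  let ?k = "\<lambda>w. ab_gen 1 [^]\<^bsub>?A\<^esub> (exp_sum 1 w) \<otimes>\<^bsub>?A\<^esub> ab_gen 2 [^]\<^bsub>?A\<^esub> (exp_sum 2 w)"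
  have "?k \<in> hom F2 ?A"
    by (rule homI) (auto simp: abF.int_pow_mult abF.m_ac)
  moreover have "ab_class (free_gen i) = ?k (free_gen i)" for i
    using exhaust_2[of i] by (auto simp: exp_sum_gen ab_gen_def[symmetric])
  ultimately show ?thesis using abF.free_hom_unique[OF ab_class_hom] assms by blast
qed

lemma exp_sum_coords:
  assumes "w \<in> carrier F2"
    and "ab_class w = ab_gen 1 [^]\<^bsub>abelianization F2\<^esub> a \<otimes>\<^bsub>abelianization F2\<^esub>
     ab_gen 2 [^]\<^bsub>abelianization F2\<^esub> b"
  shows "exp_sum 1 w = a" "exp_sum 2 w = b"
proof -
  let ?v = "free_gen 1 [^]\<^bsub>F2\<^esub> a \<otimes>\<^bsub>F2\<^esub> free_gen 2 [^]\<^bsub>F2\<^esub> b"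
  have v: "?v \<in> carrier F2" by simp
  have "ab_class w = ab_class ?v"
    using assms(2) by (simp add: ab_gen_def ab_class.hom_int_pow)
  then have *: "exp_sum i w = exp_sum i ?v" for i using exp_sum_ab_class[OF _ assms(1) v] by blast
  have "exp_sum i ?v = a * exp_sum i (free_gen 1) + b * exp_sum i (free_gen 2)" for i
    by (simp add: exp_sum.hom_int_pow)
  then show "exp_sum 1 w = a" "exp_sum 2 w = b" using * by (auto simp: exp_sum_gen)
qed

lemma auto_hom: "\<phi> \<in> auto F2 \<Longrightarrow> group_hom F2 F2 \<phi>"
  by (unfold_locales) (auto simp: auto_def)

lemma auto_image: "\<phi> \<in> auto F2 \<Longrightarrow> \<phi> ` carrier F2 = carrier F2"
  by (auto simp: auto_def Bij_def bij_betw_def)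

lemma auto_closed: "\<phi> \<in> auto F2 \<Longrightarrow> w \<in> carrier F2 \<Longrightarrow> \<phi> w \<in> carrier F2"
  using auto_image by blast

lemma ab_auto_class:
  assumes "\<phi> \<in> auto F2" "w \<in> carrier F2"
  shows "ab_auto F2 \<phi> (ab_class w) = ab_class (\<phi> w)"
proof -
  interpret group_hom F2 F2 \<phi> using assms(1) by (rule auto_hom)
  let ?D = "derived F2 (carrier F2)"
  have D: "?D \<subseteq> carrier F2" by (rule free.derived_in_carrier) simp
  have "\<phi> ` ?D = ?D"
    using derived_img[of "carrier F2"] auto_image[OF assms(1)] by simp
  moreover have "\<phi> ` (ab_class w) = (\<phi> ` ?D) #>\<^bsub>F2\<^esub> (\<phi> w)"
    using D assms(2) unfolding r_coset_def by (force simp: image_iff)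
  ultimately show ?thesis
    using assms(2) ab_class.hom_closed by (simp add: ab_auto_def)
qed

lemma ab_auto_in_auto:
  assumes "\<phi> \<in> auto F2"
  shows "ab_auto F2 \<phi> \<in> auto (abelianization F2)"
proof -
  let ?A = "abelianization F2"
  let ?D = "derived F2 (carrier F2)"
  interpret group_hom F2 F2 \<phi> using assms(1) by (rule auto_hom)
  have A: "\<exists>w\<in>carrier F2. C = ab_class w" if "C \<in> carrier ?A" for C
    using that by (auto simp: abelianization_def FactGroup_def RCOSETS_def)
  have 1: "ab_auto F2 \<phi> \<in> hom ?A ?A"
  proof (rule homI)
    fix C assume "C \<in> carrier ?A"
    then show "ab_auto F2 \<phi> C \<in> carrier ?A"
      using A[of C] ab_auto_class[OF assms] by auto
  next
    fix C C' assume "C \<in> carrier ?A" "C' \<in> carrier ?A"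
    then obtain w w' where w: "w \<in> carrier F2" "w' \<in> carrier F2" "C = ab_class w" "C' = ab_class w'"
      using A by blast
    have "C \<otimes>\<^bsub>?A\<^esub> C' = ab_class (w \<otimes>\<^bsub>F2\<^esub> w')" using w by simp
    then show "ab_auto F2 \<phi> (C \<otimes>\<^bsub>?A\<^esub> C') = ab_auto F2 \<phi> C \<otimes>\<^bsub>?A\<^esub> ab_auto F2 \<phi> C'"
      using w by (simp add: ab_auto_class[OF assms] del: ab_class.hom_mult) simp
  qed
  have "inj_on (ab_auto F2 \<phi>) (carrier ?A)"
  proof (rule inj_onI)
    fix C C' assume C: "C \<in> carrier ?A" "C' \<in> carrier ?A" and eq: "ab_auto F2 \<phi> C = ab_auto F2 \<phi> C'"
    have "C \<subseteq> carrier F2" "C' \<subseteq> carrier F2"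
      using A[OF C(1)] A[OF C(2)] free.r_coset_subset_G[OF free.derived_in_carrier[OF subset_refl]] by auto
    moreover have "inj_on \<phi> (carrier F2)" using assms by (auto simp: auto_def Bij_def bij_betw_def)
    moreover have "\<phi> ` C = \<phi> ` C'" using eq C by (simp add: ab_auto_def)
    ultimately show "C = C'" by (simp add: inj_on_image_eq_iff)
  qed
  moreover have "ab_auto F2 \<phi> ` carrier ?A = carrier ?A"
  proof
    show "ab_auto F2 \<phi> ` carrier ?A \<subseteq> carrier ?A" using 1 by (auto simp: hom_def)
    show "carrier ?A \<subseteq> ab_auto F2 \<phi> ` carrier ?A"
    proof
      fix C assume "C \<in> carrier ?A"
      then obtain w where w: "w \<in> carrier F2" "C = ab_class w" using A by blast
      then obtain v where v: "v \<in> carrier F2" "w = \<phi> v" using auto_image[OF assms] by blast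
      then have "C = ab_auto F2 \<phi> (ab_class v)" using w ab_auto_class[OF assms] by simp
      then show "C \<in> ab_auto F2 \<phi> ` carrier ?A" using v(1) ab_class.hom_closed by blast
    qed
  qed
  ultimately show ?thesis
    using 1 by (simp add: auto_def Bij_def bij_betw_def) (simp add: ab_auto_def)
qed

lemma is_ab_matrix_iff:
  assumes "\<phi> \<in> auto F2"
  shows "is_ab_matrix (ab_auto F2 \<phi>) M \<longleftrightarrow> M = (\<chi> i j. exp_sum i (\<phi> (free_gen j)))"
proof -
  have c: "\<phi> (free_gen j) \<in> carrier F2" for j using auto_closed[OF assms] by simp
  have e: "ab_auto F2 \<phi> (ab_gen j) = ab_class (\<phi> (free_gen j))" for j
    by (simp add: ab_gen_def ab_auto_class[OF assms])
  show ?thesis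
  proof
    assume "is_ab_matrix (ab_auto F2 \<phi>) M"
    then have "exp_sum 1 (\<phi> (free_gen j)) = M $ 1 $ j" "exp_sum 2 (\<phi> (free_gen j)) = M $ 2 $ j" for j
      unfolding is_ab_matrix_def e using exp_sum_coords[OF c] by blast+
    then show "M = (\<chi> i j. exp_sum i (\<phi> (free_gen j)))"
      by (simp add: vec_eq_iff forall_2)
  next
    assume "M = (\<chi> i j. exp_sum i (\<phi> (free_gen j)))"
    then show "is_ab_matrix (ab_auto F2 \<phi>) M"
      unfolding is_ab_matrix_def e using ab_class_coords[OF c] by simp
  qed
qed

lemma ab_matrix_ex1: "\<phi> \<in> auto F2 \<Longrightarrow> \<exists>!M. is_ab_matrix (ab_auto F2 \<phi>) M"
  by (simp add: is_ab_matrix_iff)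

lemma rho_eq: "\<phi> \<in> auto F2 \<Longrightarrow> rho \<phi> = (\<chi> i j. exp_sum i (\<phi> (free_gen j)))"
  by (simp add: rho_def is_ab_matrix_iff)

lemma exp_sum_auto:
  assumes "\<phi> \<in> auto F2" "w \<in> carrier F2"
  shows "exp_sum i (\<phi> w) = (\<Sum>j\<in>UNIV. rho \<phi> $ i $ j * exp_sum j w)"
proof -
  interpret p: group_hom F2 F2 \<phi> using assms(1) by (rule auto_hom)
  let ?k = "\<lambda>w. \<Sum>j\<in>UNIV. rho \<phi> $ i $ j * exp_sum j w"
  have 1: "(\<lambda>w. exp_sum i (\<phi> w)) \<in> hom F2 integer_group"
    by (rule homI) auto
  have 2: "?k \<in> hom F2 integer_group"
    by (rule homI) (auto simp: algebra_simps sum.distrib)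
  have "exp_sum i (\<phi> (free_gen j)) = ?k (free_gen j)" for j
    by (simp add: exp_sum_gen rho_eq[OF assms(1)] if_distrib cong: if_cong)
  then show ?thesis
    using group.free_hom_unique[OF group_integer_group 1 2] assms(2) by blast
qed

lemma carrier_AutoGroup: "carrier (AutoGroup G) = auto G"
  by (simp add: AutoGroup_def BijGroup_def)

lemma mult_AutoGroup:
  "\<phi> \<in> auto G \<Longrightarrow> \<psi> \<in> auto G \<Longrightarrow> \<phi> \<otimes>\<^bsub>AutoGroup G\<^esub> \<psi> = compose (carrier G) \<phi> \<psi>"
  by (simp add: AutoGroup_def BijGroup_def auto_def)

lemma one_AutoGroup: "\<one>\<^bsub>AutoGroup G\<^esub> = (\<lambda>x\<in>carrier G. x)"
  by (simp add: AutoGroup_def BijGroup_def)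

lemma rho_mult:
  assumes "\<phi> \<in> auto F2" "\<psi> \<in> auto F2"
  shows "rho (\<phi> \<otimes>\<^bsub>AutoGroup F2\<^esub> \<psi>) = rho \<phi> ** rho \<psi>"
proof -
  interpret A: group "AutoGroup F2" by (rule free.AutoGroup)
  have m: "\<phi> \<otimes>\<^bsub>AutoGroup F2\<^esub> \<psi> \<in> auto F2" using A.m_closed assms by (simp add: carrier_AutoGroup)
  show ?thesis
    unfolding rho_eq[OF m] rho_eq[OF assms(2)] vec_eq_iff
    using exp_sum_auto[OF assms(1) auto_closed[OF assms(2) free_gen_closed]]
    by (simp add: matrix_matrix_mult_def compose_def mult_AutoGroup[OF assms])
qed

lemma rho_one: "rho \<one>\<^bsub>AutoGroup F2\<^esub> = mat 1"
proof -
  have "(\<lambda>x\<in>carrier F2. x) \<in> auto F2" by (rule free.id_in_auto)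
  from rho_eq[OF this] show ?thesis
    by (simp add: one_AutoGroup vec_eq_iff mat_def exp_sum_gen)
qed

lemma subgroup_Gamma_plus: "subgroup (Gamma_plus \<pi>) (AutoGroup F2)"
proof -
  interpret A: group "AutoGroup F2" by (rule free.AutoGroup)
  show ?thesis
  proof (rule A.subgroupI)
    show "Gamma_plus \<pi> \<subseteq> carrier (AutoGroup F2)"
      by (auto simp: Gamma_plus_def Aut_plus_def carrier_AutoGroup)
    have "\<one>\<^bsub>AutoGroup F2\<^esub> \<in> Gamma_plus \<pi>"
      using A.one_closed rho_one by (simp add: Gamma_plus_def Aut_plus_def carrier_AutoGroup)
        (simp add: one_AutoGroup)
    then show "Gamma_plus \<pi> \<noteq> {}" by blast
  next
    fix \<phi> assume p: "\<phi> \<in> Gamma_plus \<pi>"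
    let ?q = "inv\<^bsub>AutoGroup F2\<^esub> \<phi>"
    from p have a: "\<phi> \<in> auto F2" "det (rho \<phi>) = 1" "\<And>w. w \<in> carrier F2 \<Longrightarrow> \<pi> (\<phi> w) = \<pi> w"
      by (auto simp: Gamma_plus_def Aut_plus_def)
    have q: "?q \<in> auto F2" using A.inv_closed a(1) by (simp add: carrier_AutoGroup)
    have e: "\<phi> \<otimes>\<^bsub>AutoGroup F2\<^esub> ?q = \<one>\<^bsub>AutoGroup F2\<^esub>" using A.r_inv a(1) by (simp add: carrier_AutoGroup)
    have "det (rho \<phi> ** rho ?q) = 1" using rho_mult[OF a(1) q] e rho_one by (metis det_I)
    then have "det (rho ?q) = 1" using a(2) by (simp add: det_mul)
    moreover have "\<pi> (?q w) = \<pi> w" if "w \<in> carrier F2" for w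
    proof -
      have "compose (carrier F2) \<phi> ?q w = w"
        using e that unfolding mult_AutoGroup[OF a(1) q] one_AutoGroup by simp
      then have "\<phi> (?q w) = w" using that by (simp add: compose_def)
      then show ?thesis using a(3)[OF auto_closed[OF q that]] by simp
    qed
    ultimately show "?q \<in> Gamma_plus \<pi>" using q by (simp add: Gamma_plus_def Aut_plus_def)
  next
    fix \<phi> \<psi> assume "\<phi> \<in> Gamma_plus \<pi>" "\<psi> \<in> Gamma_plus \<pi>"
    then have a: "\<phi> \<in> auto F2" "det (rho \<phi>) = 1" "\<And>w. w \<in> carrier F2 \<Longrightarrow> \<pi> (\<phi> w) = \<pi> w"
      and b: "\<psi> \<in> auto F2" "det (rho \<psi>) = 1" "\<And>w. w \<in> carrier F2 \<Longrightarrow> \<pi> (\<psi> w) = \<pi> w"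
      by (auto simp: Gamma_plus_def Aut_plus_def)
    have "\<phi> \<otimes>\<^bsub>AutoGroup F2\<^esub> \<psi> \<in> auto F2" using A.m_closed a(1) b(1) by (simp add: carrier_AutoGroup)
    moreover have "det (rho (\<phi> \<otimes>\<^bsub>AutoGroup F2\<^esub> \<psi>)) = 1"
      unfolding rho_mult[OF a(1) b(1)] det_mul a(2) b(2) by simp
    moreover have "\<pi> ((\<phi> \<otimes>\<^bsub>AutoGroup F2\<^esub> \<psi>) w) = \<pi> w" if "w \<in> carrier F2" for w
      using a(3)[OF auto_closed[OF b(1) that]] b(3)[OF that] that
      by (simp add: mult_AutoGroup[OF a(1) b(1)] compose_def)
    ultimately show "\<phi> \<otimes>\<^bsub>AutoGroup F2\<^esub> \<psi> \<in> Gamma_plus \<pi>"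
      by (simp add: Gamma_plus_def Aut_plus_def)
  qed
qed

lemma group_Gamma_plus_group: "group (Gamma_plus_group \<pi>)"
  unfolding Gamma_plus_group_def
  by (rule group.subgroup_imp_group[OF free.AutoGroup subgroup_Gamma_plus])

end

theory Submission
  imports Defs "HOL-Algebra.Multiplicative_Group"
begin

text \<open>
  The Rademacher function \<open>\<Phi>\<close> on \<open>SL\<^sub>2(\<int>)\<close> satisfies
  \<open>\<Phi>(A B) = \<Phi>(A) + \<Phi>(B) - 3 sgn(c\<^sub>A c\<^sub>B c\<^sub>A\<^sub>B)\<close>, where \<open>c\<close> is the lower left entry. The defect only depends on
  signs of lower left entries, and these are unchanged under conjugation by an upper triangular
  matrix \<open>g\<close> with positive diagonal entries \<open>\<alpha>\<close>, \<open>\<delta>\<close>. So \<open>M \<mapsto> \<Phi>(M) - \<Phi>(g\<^sup>-\<^sup>1 M g)\<close> is a homomorphism on the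
  matrices that preserve the lattice \<open>g \<int>\<^sup>2\<close>, and it maps the shear by \<open>k\<close> to \<open>k (1 - \<delta> / \<alpha>)\<close>.
  Since \<open>G\<close> is not perfect, the image of the group in question under \<open>\<rho>\<close> preserves such a lattice with
  \<open>\<alpha> \<noteq> \<delta>\<close>. The automorphism fixing \<open>x\<close> and sending \<open>y\<close> to \<open>y x\<^sup>k\<close> with \<open>k = |G|\<close> lies in the
  group, and the homomorphism does not vanish on it.
\<close>

section \<open>Dedekind sums by Euclidean recursion\<close>

definition dedekind_reciprocity_term :: "int \<Rightarrow> int \<Rightarrow> real" where
  "dedekind_reciprocity_term h k = (h\<^sup>2 + k\<^sup>2 + 1) / (12 * h * k) - 1 / 4"

text \<open>Only meaningful for \<open>k \<ge> 1\<close> and coprime \<open>h\<close>, \<open>k\<close>. There it agrees with the classical sum of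
  products of sawtooth values, since that sum has period \<open>k\<close> in \<open>h\<close> and obeys the reciprocity law
  that serves as the recursion here.\<close>

function dedekind_sum :: "int \<Rightarrow> int \<Rightarrow> real" where
  "dedekind_sum h k = (if k \<le> 1 then 0
     else dedekind_reciprocity_term (h mod k) k - dedekind_sum k (h mod k))"
  by auto
termination by (relation "measure (\<lambda>(h, k). nat k)") auto

declare dedekind_sum.simps [simp del]

lemma dedekind_sum_one [simp]: "k \<le> 1 \<Longrightarrow> dedekind_sum h k = 0"
  by (subst dedekind_sum.simps) simp

lemma dedekind_sum_mod: "dedekind_sum (h mod k) k = dedekind_sum h k"
  by (subst (1 2) dedekind_sum.simps) simp

lemma dedekind_sum_cong: "h mod k = h' mod k \<Longrightarrow> dedekind_sum h k = dedekind_sum h' k"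
  by (metis dedekind_sum_mod)

lemma dedekind_sum_less:
  assumes "0 < h" "h < k"
  shows "dedekind_sum h k = dedekind_reciprocity_term h k - dedekind_sum k h"
  using assms by (subst dedekind_sum.simps) simp

lemma dedekind_reciprocity_term_commute:
  "dedekind_reciprocity_term h k = dedekind_reciprocity_term k h"
  by (simp add: dedekind_reciprocity_term_def algebra_simps)

text \<open>For \<open>h < k\<close> this is one step of the recursion, and the claim is symmetric
  in \<open>h\<close> and \<open>k\<close>. Coprimality reduces \<open>h = k\<close> to
  \<open>h = k = 1\<close>, where both sides vanish.\<close>

lemma dedekind_sum_reciprocity:
  assumes "0 < h" "0 < k" "coprime h k"
  shows "dedekind_sum h k + dedekind_sum k h = dedekind_reciprocity_term h k"
proof -
  consider "h < k" | "k < h" | "h = k" by linarith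
  then show ?thesis
  proof cases
    case 3
    then have "h = 1" "k = 1" using assms by auto
    then show ?thesis by (simp add: dedekind_reciprocity_term_def)
  qed (use assms in \<open>auto simp: dedekind_sum_less dedekind_reciprocity_term_commute\<close>)
qed

lemma dedekind_reciprocity_term_add:
  assumes "0 < h" "0 < l"
  shows "dedekind_reciprocity_term h (h + l) + dedekind_reciprocity_term l (h + l)
    = dedekind_reciprocity_term h l"
proof -
  define x y where "x = real_of_int h" and "y = real_of_int l"
  have "x > 0" "y > 0" using assms by (auto simp: x_def y_def)
  then have "(x\<^sup>2 + (x + y)\<^sup>2 + 1) / (12 * x * (x + y)) - 1 / 4
      + ((y\<^sup>2 + (x + y)\<^sup>2 + 1) / (12 * y * (x + y)) - 1 / 4)
    = (x\<^sup>2 + y\<^sup>2 + 1) / (12 * x * y) - 1 / 4"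
    by (simp add: divide_simps add_eq_0_iff) (simp add: algebra_simps power2_eq_square)
  then show ?thesis by (simp add: dedekind_reciprocity_term_def x_def y_def)
qed

text \<open>Modulo \<open>k\<close>, \<open>h\<close> reduces to \<open>r\<close> and
  \<open>- h\<close> to \<open>l = k - r\<close>. One recursion step leads to the pairs
  \<open>(k, l)\<close> and \<open>(k, r)\<close>, which reduce to \<open>(r, l)\<close> and
  \<open>(l, r)\<close>; reciprocity for these cancels the two reciprocity terms.\<close>

lemma dedekind_sum_minus:
  assumes "0 < k" "coprime h k"
  shows "dedekind_sum (- h) k = - dedekind_sum h k"
proof (cases "k = 1")
  case False
  define r where "r = h mod k"
  define l where "l = k - r"
  have "coprime r k" using assms by (simp add: r_def)
  have "r \<noteq> 0" using \<open>coprime r k\<close> False assms(1) by auto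
  moreover have "0 \<le> r" "r < k" using assms(1) by (simp_all add: r_def)
  ultimately have r: "0 < r" "r < k" by simp_all
  have k: "k = r + l" by (simp add: l_def)
  have l: "0 < l" "l < k" using r by (auto simp: l_def)
  have "coprime r l" using \<open>coprime r k\<close> by (simp add: k coprime_iff_gcd_eq_1)
  have "(- h) mod k = l mod k"
    unfolding l_def r_def by (simp add: mod_simps)
  then have "dedekind_sum (- h) k + dedekind_sum h k = dedekind_sum l k + dedekind_sum r k"
    using dedekind_sum_cong[of "- h" k l] dedekind_sum_mod[of h k] by (simp add: r_def)
  also have "\<dots> = dedekind_reciprocity_term l k + dedekind_reciprocity_term r k
      - (dedekind_sum k l + dedekind_sum k r)"
    using r l by (simp add: dedekind_sum_less)
  also have "dedekind_sum k l = dedekind_sum r l" by (rule dedekind_sum_cong) (simp add: k)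
  also have "dedekind_sum k r = dedekind_sum l r" by (rule dedekind_sum_cong) (simp add: k)
  also have "dedekind_reciprocity_term l k + dedekind_reciprocity_term r k = dedekind_reciprocity_term r l"
    using dedekind_reciprocity_term_add[OF r(1) l(1)] by (simp add: k)
  also have "\<dots> - (dedekind_sum r l + dedekind_sum l r) = 0"
    using dedekind_sum_reciprocity[OF r(1) l(1) \<open>coprime r l\<close>] by simp
  finally show ?thesis by simp
qed simp

section \<open>The Rademacher function\<close>

definition mat2 :: "'a::zero \<Rightarrow> 'a \<Rightarrow> 'a \<Rightarrow> 'a \<Rightarrow> 'a^2^2" where
  "mat2 a b c d = vector [vector [a, b], vector [c, d]]"

lemma mat2_nth [simp]:
  "mat2 a b c d $ 1 $ 1 = a" "mat2 a b c d $ 1 $ 2 = b"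
  "mat2 a b c d $ 2 $ 1 = c" "mat2 a b c d $ 2 $ 2 = d"
  by (simp_all add: mat2_def)

lemma mat2_eq_iff:
  "(M :: 'a::zero^2^2) = N \<longleftrightarrow> M $ 1 $ 1 = N $ 1 $ 1 \<and> M $ 1 $ 2 = N $ 1 $ 2 \<and>
     M $ 2 $ 1 = N $ 2 $ 1 \<and> M $ 2 $ 2 = N $ 2 $ 2"
  by (auto simp: vec_eq_iff forall_2)

lemma matrix_mult_nth_2:
  "((M :: 'a::semiring_1^2^2) ** N) $ i $ j = M $ i $ 1 * N $ 1 $ j + M $ i $ 2 * N $ 2 $ j"
  by (simp add: matrix_matrix_mult_def sum_2)

definition rademacher :: "int^2^2 \<Rightarrow> real" where
  "rademacher M = (if M $ 2 $ 1 = 0 then M $ 1 $ 2 / M $ 2 $ 2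
     else (M $ 1 $ 1 + M $ 2 $ 2) / M $ 2 $ 1
       - 12 * of_int (sgn (M $ 2 $ 1)) * dedekind_sum (M $ 2 $ 2) \<bar>M $ 2 $ 1\<bar>)"

text \<open>Up to sign, the cyclic orientation of the triple of cusps \<open>\<infinity>\<close>, \<open>A \<infinity>\<close>, \<open>A B \<infinity>\<close>: the three factors
  are the determinants of pairs of first columns. Hence it is a cocycle.\<close>

definition orientation :: "int^2^2 \<Rightarrow> int^2^2 \<Rightarrow> int" where
  "orientation A B = sgn (A $ 2 $ 1 * B $ 2 $ 1 * (A ** B) $ 2 $ 1)"

text \<open>Both sides of the defining equation are cocycle expressions, so this property is closed under
  products in \<open>B\<close> and only has to be checked for the generators \<open>mat2 1 k 0 1\<close> and \<open>mat2 0 (-1) 1 0\<close>.\<close>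

definition rademacher_right :: "int^2^2 \<Rightarrow> bool" where
  "rademacher_right B \<longleftrightarrow> (\<forall>A. det A = 1 \<longrightarrow>
     rademacher (A ** B) = rademacher A + rademacher B - 3 * orientation A B)"

lemma int_mult_eq_1_cases: "(a::int) * d = 1 \<Longrightarrow> a = 1 \<and> d = 1 \<or> a = -1 \<and> d = -1"
  by (metis zmult_eq_1_iff)

text \<open>With \<open>a\<close>, \<open>b\<close>, \<open>c\<close>, \<open>d\<close> the entries
  of \<open>A\<close>, the shear adds \<open>c * k\<close> to \<open>d\<close>. For
  \<open>c \<noteq> 0\<close> the Dedekind sum is unchanged by periodicity and
  \<open>(a + d) / c\<close> grows by \<open>k\<close>; for \<open>c = 0\<close>,
  \<open>b / d\<close> grows by \<open>k\<close> because \<open>a = d\<close>. The orientation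
  vanishes.\<close>

lemma rademacher_right_shear: "rademacher_right (mat2 1 k 0 1)"
  unfolding rademacher_right_def
proof (intro allI impI)
  fix A :: "int^2^2" assume "det A = 1"
  then have d: "A $ 1 $ 1 * A $ 2 $ 2 - A $ 1 $ 2 * A $ 2 $ 1 = 1" by (simp add: det_2)
  show "rademacher (A ** mat2 1 k 0 1) =
      rademacher A + rademacher (mat2 1 k 0 1) - 3 * orientation A (mat2 1 k 0 1)"
  proof (cases "A $ 2 $ 1 = 0")
    case True
    then show ?thesis using d int_mult_eq_1_cases[of "A $ 1 $ 1" "A $ 2 $ 2"]
      by (auto simp: rademacher_def orientation_def matrix_mult_nth_2)
  next
    case False
    have "dedekind_sum (A $ 2 $ 1 * k + A $ 2 $ 2) \<bar>A $ 2 $ 1\<bar> = dedekind_sum (A $ 2 $ 2) \<bar>A $ 2 $ 1\<bar>"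
      by (rule dedekind_sum_cong) (simp add: mod_eq_dvd_iff)
    with False show ?thesis
      by (simp add: rademacher_def orientation_def matrix_mult_nth_2 field_simps)
  qed
qed

text \<open>Oddness in \<open>h\<close> makes the prefactor symmetric in \<open>h\<close> and
  \<open>k\<close>, so that reciprocity can be applied to the absolute values.\<close>

lemma dedekind_sum_sgn:
  assumes "k \<noteq> 0" "coprime h k" "h \<noteq> 0"
  shows "of_int (sgn k) * dedekind_sum h \<bar>k\<bar> = of_int (sgn (h * k)) * dedekind_sum \<bar>h\<bar> \<bar>k\<bar>"
  using assms dedekind_sum_minus[of "\<bar>k\<bar>" h] by (auto simp: sgn_if abs_if mult_less_0_iff zero_less_mult_iff)

text \<open>This is the reciprocity law in matrix form: the lower row \<open>(c, d)\<close> becomes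
  \<open>(d, - c)\<close>.\<close>

lemma rademacher_right_S: "rademacher_right (mat2 0 (-1) 1 0)"
  unfolding rademacher_right_def
proof (intro allI impI)
  fix A :: "int^2^2" assume "det A = 1"
  define a b c d where abcd: "a = A $ 1 $ 1" "b = A $ 1 $ 2" "c = A $ 2 $ 1" "d = A $ 2 $ 2"
  have det: "a * d - b * c = 1" using \<open>det A = 1\<close> by (simp add: det_2 abcd)
  let ?S = "mat2 0 (-1) 1 0 :: int^2^2"
  have S: "rademacher ?S = 0" by (simp add: rademacher_def)
  have AS: "A ** ?S = mat2 b (-a) d (-c)" by (simp add: mat2_eq_iff matrix_mult_nth_2 abcd)
  have A: "rademacher A = rademacher (mat2 a b c d)" by (simp add: rademacher_def abcd)
  have o: "orientation A ?S = sgn (c * d)" by (simp add: orientation_def matrix_mult_nth_2 abcd)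
  have "rademacher (mat2 b (-a) d (-c)) = rademacher (mat2 a b c d) - 3 * sgn (c * d)"
  proof -
    consider "c = 0" | "d = 0" | "c \<noteq> 0" "d \<noteq> 0" by blast
    then show ?thesis
    proof cases
      case 1
      then have "a = 1 \<and> d = 1 \<or> a = -1 \<and> d = -1" using det int_mult_eq_1_cases[of a d] by simp
      then show ?thesis using 1 by (auto simp: rademacher_def)
    next
      case 2
      then have "b = 1 \<and> c = -1 \<or> b = -1 \<and> c = 1" using det int_mult_eq_1_cases[of "-b" c] by auto
      then show ?thesis using 2 by (auto simp: rademacher_def)
    next
      case 3
      have cop: "coprime c d"
      proof (rule coprimeI)
        fix e assume "e dvd c" "e dvd d"
        then have "e dvd a * d - b * c" by simp
        then show "is_unit e" by (simp add: det)
      qed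
      let ?s = "real_of_int (sgn (c * d))"
      have 1: "of_int (sgn d) * dedekind_sum (-c) \<bar>d\<bar> = - (?s * dedekind_sum \<bar>c\<bar> \<bar>d\<bar>)"
        using dedekind_sum_sgn[of d "-c"] 3 cop by simp
      have 2: "of_int (sgn c) * dedekind_sum d \<bar>c\<bar> = ?s * dedekind_sum \<bar>d\<bar> \<bar>c\<bar>"
        using dedekind_sum_sgn[of c d] 3 cop by (simp add: coprime_commute mult.commute)
      have rec: "dedekind_sum \<bar>c\<bar> \<bar>d\<bar> + dedekind_sum \<bar>d\<bar> \<bar>c\<bar> = dedekind_reciprocity_term \<bar>c\<bar> \<bar>d\<bar>"
        using dedekind_sum_reciprocity[of "\<bar>c\<bar>" "\<bar>d\<bar>"] 3 cop by simp
      \<comment> \<open>The determinant stands for the summand 1 in the numerator of the reciprocity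
        term.\<close>
      have "(b - c) / d - (a + d) / c = - ((c\<^sup>2 + d\<^sup>2 + (a * d - b * c)) / real_of_int (c * d))"
        using 3 by (simp add: field_simps power2_eq_square)
      also have "\<dots> = - ?s * (12 * dedekind_reciprocity_term \<bar>c\<bar> \<bar>d\<bar> + 3)"
        using 3 unfolding det dedekind_reciprocity_term_def
        by (auto simp: sgn_if abs_if mult_less_0_iff zero_less_mult_iff field_simps)
      finally have "(b - c) / d - (a + d) / c = - ?s * (12 * dedekind_reciprocity_term \<bar>c\<bar> \<bar>d\<bar> + 3)" .
      then have "(b - c) / d + 12 * (?s * dedekind_sum \<bar>c\<bar> \<bar>d\<bar>) = (a + d) / c - 12 * (?s * dedekind_sum \<bar>d\<bar> \<bar>c\<bar>) - 3 * ?s"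
        unfolding rec[symmetric] by (simp add: algebra_simps)
      then show ?thesis using 3 1 2 by (simp add: rademacher_def mult.assoc)
    qed
  qed
  then show "rademacher (A ** ?S) = rademacher A + rademacher ?S - 3 * orientation A ?S"
    by (simp add: AS A S o)
qed

section \<open>The cocycle identity for the orientation\<close>

lemma lower_left_zero:
  fixes A B :: "int^2^2"
  assumes "det A = 1" "det B = 1"
  shows "A $ 2 $ 1 = 0 \<Longrightarrow> B $ 2 $ 1 = 0 \<longleftrightarrow> (A ** B) $ 2 $ 1 = 0"
    "B $ 2 $ 1 = 0 \<Longrightarrow> A $ 2 $ 1 = 0 \<longleftrightarrow> (A ** B) $ 2 $ 1 = 0"
  using assms by (auto simp: det_2 matrix_mult_nth_2)

lemma sgn_add_int:
  fixes x y :: int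
  shows "sgn x = sgn y \<Longrightarrow> sgn (x + y) = sgn x"
  by (cases "x = 0"; cases "x > 0"; cases "y = 0"; cases "y > 0"; simp add: sgn_if)

text \<open>The letters are the six minors of a \<open>2 \<times> 4\<close> matrix without zero column: \<open>p\<close>, \<open>s\<close>, \<open>m\<close> pair the first
  column with the others, \<open>q\<close>, \<open>t\<close> the second, and \<open>r\<close> the last two. The assumptions are the
  Pluecker relation and transitivity of parallelism.\<close>

lemma sgn_pluecker:
  fixes p q r s t m :: int
  assumes "s * t = p * r + m * q"
    and "p = 0 \<Longrightarrow> q = 0 \<longleftrightarrow> s = 0" "q = 0 \<Longrightarrow> p = 0 \<longleftrightarrow> s = 0"
    and "s = 0 \<Longrightarrow> r = 0 \<longleftrightarrow> m = 0" "r = 0 \<Longrightarrow> s = 0 \<longleftrightarrow> m = 0"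
    and "p = 0 \<Longrightarrow> t = 0 \<longleftrightarrow> m = 0" "t = 0 \<Longrightarrow> p = 0 \<longleftrightarrow> m = 0"
    and "q = 0 \<Longrightarrow> r = 0 \<longleftrightarrow> t = 0" "r = 0 \<Longrightarrow> q = 0 \<longleftrightarrow> t = 0"
  shows "sgn (p * q * s) + sgn (s * r * m) = sgn (p * t * m) + sgn (q * r * t)"
proof -
  define P Q R S T M where sg: "P = sgn p" "Q = sgn q" "R = sgn r" "S = sgn s" "T = sgn t" "M = sgn m"
  have z: "p = 0 \<longleftrightarrow> P = 0" "q = 0 \<longleftrightarrow> Q = 0" "r = 0 \<longleftrightarrow> R = 0" "s = 0 \<longleftrightarrow> S = 0" "t = 0 \<longleftrightarrow> T = 0" "m = 0 \<longleftrightarrow> M = 0"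
    unfolding sg sgn_0_0 by (rule refl)+
  note nz = assms(2-9)[unfolded z]
  have tri: "sgn x = 0 \<or> sgn x = 1 \<or> sgn x = -1" for x :: int
    unfolding sgn_if by simp
  note pm = tri[of p, folded sg] tri[of q, folded sg] tri[of r, folded sg]
    tri[of s, folded sg] tri[of t, folded sg] tri[of m, folded sg]
  have sgs: "sgn (s * t) = S * T" "sgn (p * r) = P * R" "sgn (m * q) = M * Q"
    by (simp_all only: sg sgn_mult)
  \<comment> \<open>From here on the Pluecker relation enters only through what it implies for the
    signs of its three products.\<close>
  have e1: "P * R = M * Q \<Longrightarrow> S * T = P * R"
    using sgn_add_int[of "p * r" "m * q"] unfolding assms(1)[symmetric] sgs by blast
  have e2: "P * R = 0 \<Longrightarrow> S * T = M * Q"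
    using assms(1) sgs by (metis add_0 sgn_0_0)
  have e3: "M * Q = 0 \<Longrightarrow> S * T = P * R"
    using assms(1) sgs by (metis add.right_neutral sgn_0_0)
  have e4: "S * T = 0 \<Longrightarrow> P * R = - (M * Q)"
  proof -
    assume "S * T = 0"
    then have "p * r = - (m * q)" using assms(1) sgs(1) sgn_0_0[of "s * t"] by linarith
    then have "sgn (p * r) = - sgn (m * q)" by simp
    then show "P * R = - (M * Q)" by (simp only: sgs)
  qed
  have "P * Q * S + S * R * M = P * T * M + Q * R * T"
  proof -
    have sq: "X * X = 1" if "X \<noteq> 0" "X = 0 \<or> X = 1 \<or> X = -1" for X :: int using that by auto
    consider "P = 0" | "Q = 0" | "R = 0" | "S = 0" | "T = 0" | "M = 0"
      | "P = 1 \<or> P = -1" "Q = 1 \<or> Q = -1" "R = 1 \<or> R = -1"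
      "S = 1 \<or> S = -1" "T = 1 \<or> T = -1" "M = 1 \<or> M = -1" using pm by argo
    then show ?thesis
    proof cases
      case 7
      \<comment> \<open>If \<open>P * R = M * Q\<close>, each side is twice one of its terms and
        \<open>e1\<close> equates them; otherwise both sides vanish.\<close>
      then show ?thesis using e1 by (elim disjE; hypsubst; simp)
    next
      case 1
      then have st: "S * T = M * Q" using e2 by simp
      have "S * M = Q * T \<or> S = 0 \<or> T = 0 \<or> M = 0 \<or> Q = 0"
        using pm(2,4-6) st by (elim disjE; hypsubst; simp)
      then show ?thesis using 1 nz(1,5) by (auto simp: algebra_simps)
    next
      case 2
      then have st: "S * T = P * R" using e3 by simp
      have "S * R = P * T \<or> S = 0 \<or> T = 0 \<or> P = 0 \<or> R = 0"
        using pm(1,3-5) st by (elim disjE; hypsubst; simp)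
      then show ?thesis using 2 nz(2,7) by (auto simp: algebra_simps)
    next
      case 3
      then have st: "S * T = M * Q" using e2 by simp
      have "S * Q = M * T \<or> S = 0 \<or> T = 0 \<or> M = 0 \<or> Q = 0"
        using pm(2,4-6) st by (elim disjE; hypsubst; simp)
      then show ?thesis using 3 nz(4,8) by (auto simp: algebra_simps)
    next
      case 4
      then have st: "P * R = - (M * Q)" using e4 by simp
      have "P * M + Q * R = 0 \<or> R = 0 \<or> P = 0 \<or> M = 0 \<or> Q = 0"
        using pm(1-3,6) st by (elim disjE; hypsubst; simp)
      moreover have "P * T * M + Q * R * T = (P * M + Q * R) * T" by (simp add: algebra_simps)
      ultimately show ?thesis using 4 nz(1,2,3) by auto
    next
      case 5
      then have st: "P * R = - (M * Q)" using e4 by simp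
      have "P * Q + R * M = 0 \<or> R = 0 \<or> P = 0 \<or> M = 0 \<or> Q = 0"
        using pm(1-3,6) st by (elim disjE; hypsubst; simp)
      moreover have "P * Q * S + S * R * M = (P * Q + R * M) * S" by (simp add: algebra_simps)
      ultimately show ?thesis using 5 nz(6,7,8) by auto
    next
      case 6
      then have st: "S * T = P * R" using e3 by simp
      have "P * S = R * T \<or> S = 0 \<or> T = 0 \<or> P = 0 \<or> R = 0"
        using pm(1,3-5) st by (elim disjE; hypsubst; simp)
      then show ?thesis using 6 nz(3-6) by (auto simp: algebra_simps)
    qed
  qed
  then show ?thesis by (simp only: sgn_mult sg)
qed

text \<open>The lower left entries of the six products are the minors of the matrix whose columns
  are the first columns of \<open>mat 1\<close>, \<open>A\<close>, \<open>A ** B\<close> and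
  \<open>A ** B ** C\<close>.\<close>

lemma orientation_cocycle:
  assumes "det A = 1" "det B = 1" "det C = 1"
  shows "orientation A B + orientation (A ** B) C = orientation A (B ** C) + orientation B C"
proof -
  have AB: "det (A ** B) = 1" and BC: "det (B ** C) = 1" using assms by (simp_all add: det_mul)
  have pluecker: "(A ** B) $ 2 $ 1 * (B ** C) $ 2 $ 1
      = A $ 2 $ 1 * C $ 2 $ 1 + ((A ** B) ** C) $ 2 $ 1 * B $ 2 $ 1"
  proof -
    \<comment> \<open>With \<open>det B\<close> kept as a factor, this is a polynomial
      identity.\<close>
    have "(A ** B) $ 2 $ 1 * (B ** C) $ 2 $ 1
        = A $ 2 $ 1 * C $ 2 $ 1 * det B + ((A ** B) ** C) $ 2 $ 1 * B $ 2 $ 1"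
      unfolding det_2 matrix_mult_nth_2 by (simp add: algebra_simps)
    then show ?thesis using assms(2) by simp
  qed
  show ?thesis
    unfolding orientation_def matrix_mul_assoc
    by (rule sgn_pluecker[OF pluecker])
      (fact lower_left_zero[OF assms(1,2)] lower_left_zero[OF AB assms(3)]
         lower_left_zero[OF assms(1) BC, unfolded matrix_mul_assoc] lower_left_zero[OF assms(2,3)])+
qed

section \<open>From the generators to all matrices of determinant one\<close>

lemma rademacher_right_mult:
  assumes "det B = 1" "det C = 1" "rademacher_right B" "rademacher_right C"
  shows "rademacher_right (B ** C)"
  unfolding rademacher_right_def
proof (intro allI impI)
  fix A :: "int^2^2" assume A: "det A = 1"
  have "det (A ** B) = 1" using A assms by (simp add: det_mul)
  then have "rademacher ((A ** B) ** C) = rademacher (A ** B) + rademacher C - 3 * orientation (A ** B) C"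
    using assms(4) unfolding rademacher_right_def by blast
  moreover have "rademacher (A ** B) = rademacher A + rademacher B - 3 * orientation A B"
    using assms(3) A unfolding rademacher_right_def by blast
  moreover have "rademacher (B ** C) = rademacher B + rademacher C - 3 * orientation B C"
    using assms(1,4) unfolding rademacher_right_def by blast
  ultimately show "rademacher (A ** (B ** C)) = rademacher A + rademacher (B ** C) - 3 * orientation A (B ** C)"
    using arg_cong[OF orientation_cocycle[OF A assms(1,2)], of real_of_int] by (simp add: matrix_mul_assoc)
qed

text \<open>Euclid's algorithm on the lower row: a shear followed by \<open>?S\<close> replaces
  \<open>c\<close> by \<open>d mod c\<close>, until \<open>c = 0\<close>.\<close>

lemma rademacher_right_det_1:
  assumes "det B = 1"
  shows "rademacher_right B"
  using assms
proof (induction "nat \<bar>B $ 2 $ 1\<bar>" arbitrary: B rule: less_induct)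
  case less
  define a b c d where abcd: "a = B $ 1 $ 1" "b = B $ 1 $ 2" "c = B $ 2 $ 1" "d = B $ 2 $ 2"
  have det: "a * d - b * c = 1" using less.prems by (simp add: det_2 abcd)
  let ?S = "mat2 0 (-1) 1 0 :: int^2^2"
  have dS: "det ?S = 1" and dT: "det (mat2 1 k 0 (1::int)) = 1" for k by (simp_all add: det_2)
  have SS: "rademacher_right (?S ** ?S)" "det (?S ** ?S) = 1"
    using rademacher_right_mult[OF dS dS rademacher_right_S rademacher_right_S] by (simp_all add: det_mul dS)
  show ?case
  proof (cases "c = 0")
    case True
    then consider "a = 1" "d = 1" | "a = -1" "d = -1" using det int_mult_eq_1_cases[of a d] by auto
    then show ?thesis
    proof cases
      case 1
      then have "B = mat2 1 b 0 1" using True by (simp add: mat2_eq_iff abcd)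
      then show ?thesis using rademacher_right_shear by simp
    next
      case 2
      then have "B = ?S ** ?S ** mat2 1 (-b) 0 1" using True by (simp add: mat2_eq_iff matrix_mult_nth_2 abcd)
      then show ?thesis
        using rademacher_right_mult[OF SS(2) dT SS(1) rademacher_right_shear] by simp
    qed
  next
    case False
    define q where "q = d div c"
    define C where "C = B ** mat2 1 (-q) 0 1 ** ?S"
    have C21: "C $ 2 $ 1 = d mod c"
      by (simp add: C_def matrix_mult_nth_2 q_def abcd minus_div_mult_eq_mod[symmetric] algebra_simps)
    have dC: "det C = 1" using less.prems by (simp add: C_def det_mul dS dT)
    have "\<bar>d mod c\<bar> < \<bar>c\<bar>" using False by (rule abs_mod_less)
    then have "rademacher_right C" using less.hyps[OF _ dC] by (simp add: C21 abcd)
    then have 1: "rademacher_right (C ** (?S ** ?S))" "det (C ** (?S ** ?S)) = 1"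
      using rademacher_right_mult[OF dC SS(2) _ SS(1)] by (simp_all add: det_mul dC dS)
    then have 2: "rademacher_right (C ** (?S ** ?S) ** ?S)" "det (C ** (?S ** ?S) ** ?S) = 1"
      using rademacher_right_mult[OF 1(2) dS 1(1) rademacher_right_S] by (simp_all add: det_mul dC dS)
    \<comment> \<open>\<open>?S\<close> has order four, so three more copies undo the one in
      \<open>C\<close>.\<close>
    have "B = C ** (?S ** ?S) ** ?S ** mat2 1 q 0 1"
      by (simp add: C_def mat2_eq_iff matrix_mult_nth_2)
    then show ?thesis
      using rademacher_right_mult[OF 2(2) dT 2(1) rademacher_right_shear] by simp
  qed
qed

theorem rademacher_mult:
  assumes "det A = 1" "det B = 1"
  shows "rademacher (A ** B) = rademacher A + rademacher B - 3 * orientation A B"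
  using rademacher_right_det_1[OF assms(2)] assms(1) unfolding rademacher_right_def by blast

section \<open>Abelianizations and shears\<close>

text \<open>Being additive, \<open>h\<close> is constant on cosets of the derived subgroup, and it
  separates the cosets of the powers of \<open>x\<close>.\<close>

lemma (in group) infinite_abelianization:
  fixes h :: "'a \<Rightarrow> real"
  assumes add: "\<And>x y. x \<in> carrier G \<Longrightarrow> y \<in> carrier G \<Longrightarrow> h (x \<otimes> y) = h x + h y"
    and x: "x \<in> carrier G" "h x \<noteq> 0"
  shows "infinite (carrier (abelianization G))"
proof
  assume fin: "finite (carrier (abelianization G))"
  let ?D = "derived G (carrier G)"
  have one: "h \<one> = 0" using add[of \<one> \<one>] by simp
  have inv: "h (inv y) = - h y" if "y \<in> carrier G" for y
    using add[of y "inv y"] that one by simp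
  have sub: "derived_set G (carrier G) \<subseteq> carrier G" by (rule derived_set_in_carrier) simp
  have D: "?D \<subseteq> carrier G" by (rule derived_in_carrier) simp
  have zero: "h y = 0" if "y \<in> ?D" for y
    using that unfolding derived_def
  proof (induction rule: generate.induct)
    case (eng h1 h2)
    then show ?case
      using generate_in_carrier[OF sub eng(1)] generate_in_carrier[OF sub eng(2)] add by simp
  qed (auto simp: one inv add)
  have pow: "h (x [^] n) = n * h x" for n :: nat
    by (induction n) (auto simp: one add x(1) algebra_simps)
  have "h ` (?D #> x [^] n) = {n * h x}" for n :: nat
  proof -
    have "h (d \<otimes> x [^] n) = n * h x" if "d \<in> ?D" for d
      using that D zero[OF that] add[of d "x [^] n"] x(1) pow by auto
    moreover have "\<one> \<in> ?D" by (simp add: derived_def generate.one)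
    ultimately show ?thesis unfolding r_coset_def by force
  qed
  moreover have "?D #> x [^] n \<in> carrier (abelianization G)" for n :: nat
    using x(1) by (auto simp: abelianization_def FactGroup_def RCOSETS_def)
  ultimately have "{n * h x} \<in> (`) h ` carrier (abelianization G)" for n :: nat
    by (metis image_eqI)
  then have "range (\<lambda>n::nat. {n * h x}) \<subseteq> (`) h ` carrier (abelianization G)" by blast
  then have "finite (range (\<lambda>n::nat. {n * h x}))"
    by (rule finite_subset[OF _ finite_imageI[OF fin]])
  moreover have "inj (\<lambda>n::nat. {n * h x})" using x(2) by (simp add: inj_on_def)
  ultimately show False using range_inj_infinite by blast
qed

text \<open>Restricted to the carrier because the elements of \<open>auto F2\<close> are extensional
  functions.\<close>

definition shear :: "int \<Rightarrow> (2 \<times> bool) list \<Rightarrow> (2 \<times> bool) list" where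
  "shear k = restrict (free_lift F2 (\<lambda>i. if i = 1 then free_gen 1
     else free_gen 2 \<otimes>\<^bsub>F2\<^esub> free_gen 1 [^]\<^bsub>F2\<^esub> k)) (carrier F2)"

lemma shear_hom: "shear k \<in> hom F2 F2"
  unfolding shear_def by (rule free.hom_restrict[OF free.free_lift_hom]) auto

lemma shear_gen:
  "shear k (free_gen 1) = free_gen 1"
  "shear k (free_gen 2) = free_gen 2 \<otimes>\<^bsub>F2\<^esub> free_gen 1 [^]\<^bsub>F2\<^esub> k"
  unfolding shear_def by (simp_all, (subst free.free_lift_gen; auto)+)

lemma shear_shear:
  assumes "w \<in> carrier F2"
  shows "shear k (shear (- k) w) = w"
proof -
  interpret p: group_hom F2 F2 "shear k" by unfold_locales (rule shear_hom)
  have 1: "shear k \<circ> shear (- k) \<in> hom F2 F2" by (rule Group.hom_compose[OF shear_hom shear_hom])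
  have 2: "(\<lambda>w. w) \<in> hom F2 F2" by (rule homI) auto
  have 3: "(shear k \<circ> shear (- k)) (free_gen i) = free_gen i" for i
    using exhaust_2[of i]
    by (auto simp: shear_gen p.hom_int_pow free.m_assoc simp flip: free.int_pow_mult)
  show ?thesis using free.free_hom_unique[OF 1 2 3 assms] by simp
qed

lemma shear_auto: "shear k \<in> auto F2"
proof -
  have "shear k w \<in> carrier F2" if "w \<in> carrier F2" for k w
    using shear_hom that by (rule hom_in_carrier)
  then have "bij_betw (shear k) (carrier F2) (carrier F2)"
    using shear_shear[of _ k] shear_shear[of _ "-k"]
    by (intro bij_betw_byWitness[where f' = "shear (- k)"]) auto
  then show ?thesis using shear_hom by (simp add: auto_def Bij_def shear_def)
qed

lemma rho_shear: "rho (shear k) = (\<chi> i j. if i = 1 \<and> j = 2 then k else if i = j then 1 else 0)"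
proof -
  have "exp_sum i (shear k (free_gen j)) = (if i = 1 \<and> j = 2 then k else if i = j then 1 else 0)" for i j
    using exhaust_2[of i] exhaust_2[of j] by (auto simp: shear_gen exp_sum_gen exp_sum.hom_int_pow)
  then show ?thesis by (simp add: rho_eq[OF shear_auto])
qed

lemma shear_in_Gamma_plus:
  assumes "group G" "\<pi> \<in> hom F2 G" "\<pi> (free_gen 1) [^]\<^bsub>G\<^esub> k = \<one>\<^bsub>G\<^esub>"
  shows "shear k \<in> Gamma_plus \<pi>"
proof -
  interpret group G by fact
  interpret \<pi>: group_hom F2 G \<pi> by unfold_locales fact
  have 1: "\<pi> \<circ> shear k \<in> hom F2 G" by (rule Group.hom_compose[OF shear_hom assms(2)])
  have 2: "(\<pi> \<circ> shear k) (free_gen i) = \<pi> (free_gen i)" for i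
    using exhaust_2[of i] assms(3) by (auto simp: shear_gen \<pi>.hom_int_pow)
  have "\<pi> (shear k w) = \<pi> w" if "w \<in> carrier F2" for w
    using free_hom_unique[OF 1 assms(2) 2 that] by simp
  moreover have "det (rho (shear k)) = 1" by (simp add: rho_shear det_2)
  ultimately show ?thesis using shear_auto by (simp add: Gamma_plus_def Aut_plus_def)
qed

section \<open>Lattices preserved by the matrices\<close>

lemma hom_F2_comm_group:
  assumes "comm_group A" "q \<in> hom F2 A" "w \<in> carrier F2"
  shows "q w = q (free_gen 1) [^]\<^bsub>A\<^esub> exp_sum 1 w \<otimes>\<^bsub>A\<^esub> q (free_gen 2) [^]\<^bsub>A\<^esub> exp_sum 2 w"
proof -
  interpret comm_group A by fact
  interpret q: group_hom F2 A q by unfold_locales fact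
  let ?k = "\<lambda>w. q (free_gen 1) [^]\<^bsub>A\<^esub> exp_sum 1 w \<otimes>\<^bsub>A\<^esub> q (free_gen 2) [^]\<^bsub>A\<^esub> exp_sum 2 w"
  have "?k \<in> hom F2 A" by (rule homI) (auto simp: int_pow_mult m_ac)
  moreover have "q (free_gen i) = ?k (free_gen i)" for i
    using exhaust_2[of i] by (auto simp: exp_sum_gen)
  ultimately show ?thesis using free_hom_unique[OF assms(2)] assms(3) by blast
qed

text \<open>The columns of \<open>mat2 \<alpha> \<beta> 0 \<delta>\<close> span a sublattice of \<open>\<int>\<^sup>2\<close> that contains the kernel of
  \<open>\<int>\<^sup>2 \<rightarrow> A\<close>, so every \<open>rho \<phi>\<close> acting trivially modulo the kernel preserves it. With \<open>a\<close>, \<open>b\<close> the images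
  of the generators, it is the kernel itself if \<open>b \<in> \<langle>a\<rangle>\<close>, and the kernel of \<open>\<int>\<^sup>2 \<rightarrow> A / \<langle>a\<rangle>\<close> otherwise;
  taking the kernel in all cases could give \<open>\<alpha> = \<delta>\<close>.\<close>

lemma invariant_sublattice:
  assumes "comm_group A" "finite (carrier A)" "q \<in> epi F2 A" "carrier A \<noteq> {\<one>\<^bsub>A\<^esub>}"
  obtains \<alpha> \<beta> \<delta> :: int where "\<alpha> > 0" "\<delta> > 0" "\<alpha> \<noteq> \<delta>"
    "\<forall>\<phi>\<in>auto F2. (\<forall>i. q (\<phi> (free_gen i)) = q (free_gen i)) \<longrightarrow>
       (\<exists>M'. rho \<phi> ** mat2 \<alpha> \<beta> 0 \<delta> = mat2 \<alpha> \<beta> 0 \<delta> ** M')"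
proof -
  interpret A: comm_group A by fact
  have q: "q \<in> hom F2 A" "q ` carrier F2 = carrier A" using assms(3) by (auto simp: epi_def)
  interpret q: group_hom F2 A q by unfold_locales fact
  define a b where "a = q (free_gen 1)" and "b = q (free_gen 2)"
  have ab: "a \<in> carrier A" "b \<in> carrier A" by (simp_all add: a_def b_def)
  have rel: "a [^]\<^bsub>A\<^esub> (rho \<phi> $ 1 $ j) \<otimes>\<^bsub>A\<^esub> b [^]\<^bsub>A\<^esub> (rho \<phi> $ 2 $ j) = q (free_gen j)"
    if "\<phi> \<in> auto F2" "\<And>i. q (\<phi> (free_gen i)) = q (free_gen i)" for \<phi> j
    using hom_F2_comm_group[OF assms(1) q(1), of "\<phi> (free_gen j)"] that
    by (simp add: rho_eq auto_closed a_def b_def)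
  have img: "carrier A = range (\<lambda>(k::int, l::int). a [^]\<^bsub>A\<^esub> k \<otimes>\<^bsub>A\<^esub> b [^]\<^bsub>A\<^esub> l)"
  proof
    show "carrier A \<subseteq> range (\<lambda>(k::int, l::int). a [^]\<^bsub>A\<^esub> k \<otimes>\<^bsub>A\<^esub> b [^]\<^bsub>A\<^esub> l)"
    proof
      fix x assume "x \<in> carrier A"
      then obtain w where "w \<in> carrier F2" "x = q w" using q(2) by blast
      then have "x = (\<lambda>(k::int, l::int). a [^]\<^bsub>A\<^esub> k \<otimes>\<^bsub>A\<^esub> b [^]\<^bsub>A\<^esub> l) (exp_sum 1 w, exp_sum 2 w)"
        using hom_F2_comm_group[OF assms(1) q(1), of w] by (simp add: a_def b_def)
      then show "x \<in> range (\<lambda>(k::int, l::int). a [^]\<^bsub>A\<^esub> k \<otimes>\<^bsub>A\<^esub> b [^]\<^bsub>A\<^esub> l)" by (rule range_eqI)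
    qed
    show "range (\<lambda>(k::int, l::int). a [^]\<^bsub>A\<^esub> k \<otimes>\<^bsub>A\<^esub> b [^]\<^bsub>A\<^esub> l) \<subseteq> carrier A"
      using ab by (simp add: image_subset_iff split_paired_all)
  qed
  let ?H = "range (\<lambda>k::int. a [^]\<^bsub>A\<^esub> k)"
  show ?thesis
  proof (cases "b \<in> ?H")
    case True
    then obtain k :: int where k: "b = a [^]\<^bsub>A\<^esub> k" by blast
    \<comment> \<open>Since \<open>b\<close> is the \<open>k\<close>-th power of \<open>a\<close>,
      the kernel consists of the \<open>(i, j)\<close> with \<open>n dvd i + k * j\<close>. It is
      spanned by \<open>(n, 0)\<close> and \<open>(- k, 1)\<close>.\<close>
    define n where "n = int (A.ord a)"
    have "A.ord a \<noteq> 1"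
    proof
      assume "A.ord a = 1"
      then have "a = \<one>\<^bsub>A\<^esub>" using A.ord_eq_1[OF ab(1)] by simp
      then have "carrier A = {\<one>\<^bsub>A\<^esub>}" using img k by auto
      then show False using assms(4) by simp
    qed
    moreover have "A.ord a > 0" using A.ord_ge_1[OF assms(2) ab(1)] by simp
    ultimately have n: "n > 0" "n \<noteq> 1" by (auto simp: n_def)
    have ex: "\<exists>M'. rho \<phi> ** mat2 n (-k) 0 1 = mat2 n (-k) 0 1 ** M'"
      if \<phi>: "\<phi> \<in> auto F2" "\<And>i. q (\<phi> (free_gen i)) = q (free_gen i)" for \<phi>
    proof -
      define M where "M = rho \<phi>"
      have e: "a [^]\<^bsub>A\<^esub> (M $ 1 $ j + k * M $ 2 $ j) = q (free_gen j)" for j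
        using rel[OF \<phi>, of j] ab by (simp add: M_def k A.int_pow_mult A.int_pow_pow)
      have "a [^]\<^bsub>A\<^esub> (M $ 1 $ 1 + k * M $ 2 $ 1) = a [^]\<^bsub>A\<^esub> (1::int)"
        using e[of 1] ab by (simp add: a_def)
      then have 1: "n dvd 1 - (M $ 1 $ 1 + k * M $ 2 $ 1)"
        unfolding A.int_pow_eq[OF ab(1)] n_def by (metis dvd_diff_commute)
      have "a [^]\<^bsub>A\<^esub> (M $ 1 $ 2 + k * M $ 2 $ 2) = a [^]\<^bsub>A\<^esub> k"
        using e[of 2] by (simp add: b_def[symmetric] k)
      then have 2: "n dvd (M $ 1 $ 2 + k * M $ 2 $ 2) - k"
        unfolding A.int_pow_eq[OF ab(1)] n_def by (metis dvd_diff_commute)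
      \<comment> \<open>This combination is \<open>n\<close> times the upper right entry of the
        conjugated matrix, the only entry whose integrality is in question.\<close>
      have "n dvd (M $ 1 $ 2 + k * M $ 2 $ 2) - k + k * (1 - (M $ 1 $ 1 + k * M $ 2 $ 1))"
        using 1 2 by (intro dvd_add dvd_mult)
      then have "n dvd M $ 1 $ 2 + k * M $ 2 $ 2 - k * (M $ 1 $ 1 + k * M $ 2 $ 1)"
        by (simp add: algebra_simps)
      then obtain r where r: "M $ 1 $ 2 + k * M $ 2 $ 2 - k * (M $ 1 $ 1 + k * M $ 2 $ 1) = n * r" ..
      have "M ** mat2 n (-k) 0 1 = mat2 n (-k) 0 1 **
          mat2 (M $ 1 $ 1 + k * M $ 2 $ 1) r (n * M $ 2 $ 1) (M $ 2 $ 2 - k * M $ 2 $ 1)"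
        using r by (simp add: mat2_eq_iff matrix_mult_nth_2 algebra_simps)
      then show ?thesis unfolding M_def by blast
    qed
    show ?thesis by (rule that[of n 1 "-k"]) (use n ex in auto)
  next
    case False
    have H: "?H = generate A {a}" using A.generate_pow[OF ab(1)] by auto
    have sub: "subgroup ?H A" unfolding H by (rule A.generate_is_subgroup) (use ab in auto)
    have norm: "?H \<lhd> A" by (rule A.subgroup_imp_normal[OF sub])
    interpret Q: group "A Mod ?H" by (rule normal.factorgroup_is_group[OF norm])
    interpret c: group_hom A "A Mod ?H" "\<lambda>x. ?H #>\<^bsub>A\<^esub> x"
      by unfold_locales (rule normal.r_coset_hom_Mod[OF norm])
    have mem: "?H #>\<^bsub>A\<^esub> x = \<one>\<^bsub>A Mod ?H\<^esub> \<longleftrightarrow> x \<in> ?H" if "x \<in> carrier A" for x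
      using A.coset_join1[OF _ that sub] A.coset_join2[OF that sub] subgroup.subset[OF sub]
      by (auto simp: FactGroup_def)
    \<comment> \<open>The order of \<open>b\<close> modulo \<open>?H\<close> exceeds 1 because
      \<open>b\<close> lies outside \<open>?H\<close>; hence the diagonal entries 1 and
      \<open>n\<close> differ.\<close>
    define n where "n = int (Q.ord (?H #>\<^bsub>A\<^esub> b))"
    have dvd: "n dvd m" if "b [^]\<^bsub>A\<^esub> m \<in> ?H" for m :: int
      using iffD2[OF mem that] ab
      unfolding n_def c.hom_int_pow[OF ab(2)] Q.int_pow_eq_id[OF c.hom_closed[OF ab(2)]] by simp
    have fin: "finite (carrier (A Mod ?H))"
      using assms(2) by (auto simp: FactGroup_def RCOSETS_def)
    have "Q.ord (?H #>\<^bsub>A\<^esub> b) \<noteq> 1" 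
      using False mem[OF ab(2)] Q.ord_eq_1[OF c.hom_closed[OF ab(2)]] by simp
    moreover have "Q.ord (?H #>\<^bsub>A\<^esub> b) > 0" 
      using Q.ord_ge_1[OF fin c.hom_closed[OF ab(2)]] by simp
    ultimately have n: "n > 0" "n \<noteq> 1" by (auto simp: n_def)
    have ex: "\<exists>M'. rho \<phi> ** mat2 1 0 0 n = mat2 1 0 0 n ** M'"
      if \<phi>: "\<phi> \<in> auto F2" "\<And>i. q (\<phi> (free_gen i)) = q (free_gen i)" for \<phi>
    proof -
      define M where "M = rho \<phi>"
      \<comment> \<open>The first column of \<open>M\<close> expresses \<open>a\<close> in terms of
        \<open>a\<close> and \<open>b\<close>, which puts a power of \<open>b\<close> into
        \<open>?H\<close>.\<close>
      have "a [^]\<^bsub>A\<^esub> (M $ 1 $ 1) \<otimes>\<^bsub>A\<^esub> b [^]\<^bsub>A\<^esub> (M $ 2 $ 1) = a [^]\<^bsub>A\<^esub> (1::int)"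
        using rel[OF \<phi>, of 1] ab by (simp add: M_def a_def)
      then have "b [^]\<^bsub>A\<^esub> (M $ 2 $ 1) = inv\<^bsub>A\<^esub> (a [^]\<^bsub>A\<^esub> (M $ 1 $ 1)) \<otimes>\<^bsub>A\<^esub> a [^]\<^bsub>A\<^esub> (1::int)"
        using ab A.inv_solve_left' by (metis A.int_pow_closed)
      also have "\<dots> = a [^]\<^bsub>A\<^esub> (- M $ 1 $ 1 + 1)"
        using ab by (subst A.int_pow_mult) (simp_all add: A.int_pow_neg)
      finally have "n dvd M $ 2 $ 1" using dvd by blast
      then obtain r where "M $ 2 $ 1 = n * r" ..
      then have "M ** mat2 1 0 0 n = mat2 1 0 0 n ** mat2 (M $ 1 $ 1) (n * M $ 1 $ 2) r (M $ 2 $ 2)"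
        by (simp add: mat2_eq_iff matrix_mult_nth_2)
      then show ?thesis unfolding M_def by blast
    qed
    show ?thesis by (rule that[of 1 n 0]) (use n ex in auto)
  qed
qed

section \<open>Differences of Rademacher functions\<close>

text \<open>Conjugation by an upper triangular matrix with positive diagonal fixes \<open>\<infinity>\<close> and preserves
  orientation, so the two defects cancel.\<close>

lemma rademacher_diff_mult:
  fixes M M' N N' :: "int^2^2"
  assumes "\<alpha> > 0" "\<delta> > 0" "det M = 1" "det N = 1"
    "M ** mat2 \<alpha> \<beta> 0 \<delta> = mat2 \<alpha> \<beta> 0 \<delta> ** M'"
    "N ** mat2 \<alpha> \<beta> 0 \<delta> = mat2 \<alpha> \<beta> 0 \<delta> ** N'"
  shows "rademacher (M ** N) - rademacher (M' ** N')
    = (rademacher M - rademacher M') + (rademacher N - rademacher N')"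
proof -
  let ?g = "mat2 \<alpha> \<beta> 0 \<delta>"
  have det_conj: "det X' = 1" if "det X = 1" "X ** ?g = ?g ** X'" for X X' :: "int^2^2"
  proof -
    have "det ?g * det X' = det ?g" using arg_cong[OF that(2), of det] that(1) by (simp add: det_mul)
    moreover have "det ?g \<noteq> 0" using assms(1,2) by (simp add: det_2)
    ultimately show ?thesis by simp
  qed
  have sgn_conj: "sgn (X' $ 2 $ 1) = sgn (X $ 2 $ 1)" if "X ** ?g = ?g ** X'" for X X' :: "int^2^2"
  proof -
    have "X $ 2 $ 1 * \<alpha> = \<delta> * X' $ 2 $ 1"
      using arg_cong[OF that, of "\<lambda>Y. Y $ 2 $ 1"] by (simp add: matrix_mult_nth_2)
    then have "sgn (X $ 2 $ 1 * \<alpha>) = sgn (\<delta> * X' $ 2 $ 1)" by (rule arg_cong)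
    then show ?thesis using assms(1,2) by (simp add: sgn_mult)
  qed
  have "(M ** N) ** ?g = ?g ** (M' ** N')"
    by (metis assms(5,6) matrix_mul_assoc)
  then have "orientation M' N' = orientation M N"
    unfolding orientation_def sgn_mult
    using sgn_conj[OF assms(5)] sgn_conj[OF assms(6)] sgn_conj[of "M ** N" "M' ** N'"] by simp
  then show ?thesis
    using rademacher_mult[OF assms(3,4)]
      rademacher_mult[OF det_conj[OF assms(3,5)] det_conj[OF assms(4,6)]] by simp
qed

text \<open>Makes the conjugated integer matrix unique, so that choosing it for each automorphism is
  multiplicative.\<close>

lemma upper_triangular_mult_left_cancel:
  fixes X Y :: "int^2^2"
  assumes "\<alpha> \<noteq> 0" "\<delta> \<noteq> 0" "mat2 \<alpha> \<beta> 0 \<delta> ** X = mat2 \<alpha> \<beta> 0 \<delta> ** Y"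
  shows "X = Y"
  using assms by (auto simp: mat2_eq_iff matrix_mult_nth_2)

lemma infinite_abelianization_Gamma_plus:
  assumes pos: "\<alpha> > 0" "\<delta> > 0" and ne: "\<alpha> \<noteq> \<delta>"
    and conj: "\<And>\<phi>. \<phi> \<in> Gamma_plus \<pi> \<Longrightarrow> \<exists>M'. rho \<phi> ** mat2 \<alpha> \<beta> 0 \<delta> = mat2 \<alpha> \<beta> 0 \<delta> ** M'"
    and shear: "shear k \<in> Gamma_plus \<pi>" "k \<noteq> 0"
  shows "infinite (carrier (abelianization (Gamma_plus_group \<pi>)))"
proof -
  let ?g = "mat2 \<alpha> \<beta> 0 \<delta>"
  interpret \<Gamma>: group "Gamma_plus_group \<pi>" by (rule group_Gamma_plus_group)
  define c where "c \<phi> = (SOME M'. rho \<phi> ** ?g = ?g ** M')" for \<phi>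
  have c: "rho \<phi> ** ?g = ?g ** c \<phi>" if "\<phi> \<in> Gamma_plus \<pi>" for \<phi>
    unfolding c_def using conj[OF that] by (rule someI_ex)
  have c_eq: "c \<phi> = M'" if "\<phi> \<in> Gamma_plus \<pi>" "rho \<phi> ** ?g = ?g ** M'" for \<phi> M'
    using upper_triangular_mult_left_cancel[of \<alpha> \<delta> \<beta> "c \<phi>" M'] c[OF that(1)] that(2) pos by simp
  have Gamma: "\<phi> \<in> auto F2" "det (rho \<phi>) = 1" if "\<phi> \<in> Gamma_plus \<pi>" for \<phi>
    using that by (simp_all add: Gamma_plus_def Aut_plus_def)
  define h where "h \<phi> = rademacher (rho \<phi>) - rademacher (c \<phi>)" for \<phi>
  show ?thesis
  proof (rule \<Gamma>.infinite_abelianization[of h "shear k"])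
    fix \<phi> \<psi>
    assume "\<phi> \<in> carrier (Gamma_plus_group \<pi>)" "\<psi> \<in> carrier (Gamma_plus_group \<pi>)"
    then have in_Gamma: "\<phi> \<in> Gamma_plus \<pi>" "\<psi> \<in> Gamma_plus \<pi>" by (simp_all add: Gamma_plus_group_def)
    let ?\<chi> = "\<phi> \<otimes>\<^bsub>AutoGroup F2\<^esub> \<psi>"
    have rho: "rho ?\<chi> = rho \<phi> ** rho \<psi>" using in_Gamma by (simp add: rho_mult Gamma)
    have "?\<chi> \<in> Gamma_plus \<pi>" by (rule subgroup.m_closed[OF subgroup_Gamma_plus in_Gamma])
    moreover have "rho ?\<chi> ** ?g = ?g ** (c \<phi> ** c \<psi>)"
      unfolding rho using c in_Gamma by (metis matrix_mul_assoc)
    ultimately have "c ?\<chi> = c \<phi> ** c \<psi>" by (rule c_eq)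
    then show "h (\<phi> \<otimes>\<^bsub>Gamma_plus_group \<pi>\<^esub> \<psi>) = h \<phi> + h \<psi>"
      using rademacher_diff_mult[OF pos Gamma(2) Gamma(2) c c, OF in_Gamma in_Gamma]
      by (simp add: h_def rho Gamma_plus_group_def)
  next
    show "shear k \<in> carrier (Gamma_plus_group \<pi>)" using shear(1) by (simp add: Gamma_plus_group_def)
    have rho: "rho (shear k) = mat2 1 k 0 1" by (simp add: rho_shear mat2_eq_iff)
    define M where "M = c (shear k)"
    have g: "mat2 1 k 0 1 ** ?g = ?g ** M" using c[OF shear(1)] by (simp add: rho M_def)
    \<comment> \<open>Conjugation turns the shear by \<open>k\<close> into the shear by
      \<open>k * \<delta> / \<alpha>\<close>.\<close>
    then have M: "M $ 2 $ 1 = 0" "M $ 2 $ 2 = 1" "k * \<delta> = \<alpha> * M $ 1 $ 2"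
      using pos by (auto simp: mat2_eq_iff matrix_mult_nth_2)
    have "h (shear k) = k - M $ 1 $ 2" using M by (simp add: h_def rho rademacher_def flip: M_def)
    moreover have "k \<noteq> M $ 1 $ 2"
    proof
      assume "k = M $ 1 $ 2"
      then have "k * \<delta> = k * \<alpha>" using M(3) by simp
      then show False using ne shear(2) by simp
    qed
    ultimately show "h (shear k) \<noteq> 0" by simp
  qed
qed

theorem theorem1p2:
  fixes G :: "('g, 'm) monoid_scheme"
    and \<pi> :: "(2 \<times> bool) list \<Rightarrow> 'g"
  assumes "group G"
    and "finite (carrier G)"
    and "derived G (carrier G) \<noteq> carrier G"
    and "\<pi> \<in> epi F2 G"
  shows "infinite (carrier (abelianization (Gamma_plus_group \<pi>)))"
proof -
  interpret group G by fact
  let ?A = "abelianization G" and ?D = "derived G (carrier G)"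
  have A: "comm_group ?A" unfolding abelianization_def by (rule derived_quot_is_comm_group)
  have \<pi>: "\<pi> \<in> hom F2 G" "\<pi> ` carrier F2 = carrier G" using assms(4) by (auto simp: epi_def)
  \<comment> \<open>The lattice is built from the abelianization of \<open>G\<close>, which is
    nontrivial because \<open>G\<close> is not perfect. Automorphisms that preserve
    \<open>\<pi>\<close> also preserve \<open>q\<close>.\<close>
  define q where "q w = ?D #>\<^bsub>G\<^esub> \<pi> w" for w
  have carr: "carrier ?A = (\<lambda>x. ?D #>\<^bsub>G\<^esub> x) ` carrier G"
    by (auto simp: abelianization_def FactGroup_def RCOSETS_def)
  have "(\<lambda>x. ?D #>\<^bsub>G\<^esub> x) \<in> hom G ?A"
    unfolding abelianization_def by (rule normal.r_coset_hom_Mod[OF derived_self_is_normal])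
  then have "q \<in> hom F2 ?A" using Group.hom_compose[OF \<pi>(1)] unfolding q_def comp_def by blast
  moreover have "q ` carrier F2 = carrier ?A" unfolding carr \<pi>(2)[symmetric] q_def by (simp add: image_image)
  ultimately have q: "q \<in> epi F2 ?A" by (simp add: epi_def)
  have nontrivial: "carrier ?A \<noteq> {\<one>\<^bsub>?A\<^esub>}"
  proof
    assume trivial: "carrier ?A = {\<one>\<^bsub>?A\<^esub>}"
    have sub: "subgroup ?D G" by (rule derived_is_subgroup) simp
    have "x \<in> ?D" if "x \<in> carrier G" for x
    proof -
      have "?D #>\<^bsub>G\<^esub> x \<in> carrier ?A" using that by (simp add: carr)
      then have "?D #>\<^bsub>G\<^esub> x = ?D" using trivial by (simp add: abelianization_def FactGroup_def)
      then show ?thesis using rcos_self[OF that sub] by simp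
    qed
    then show False using assms(3) derived_in_carrier[of "carrier G"] by blast
  qed
  have "finite (carrier ?A)" using assms(2) by (simp add: carr)
  from invariant_sublattice[OF A this q nontrivial] obtain \<alpha> \<beta> \<delta> :: int
    where lattice: "\<alpha> > 0" "\<delta> > 0" "\<alpha> \<noteq> \<delta>"
      "\<forall>\<phi>\<in>auto F2. (\<forall>i. q (\<phi> (free_gen i)) = q (free_gen i)) \<longrightarrow>
         (\<exists>M'. rho \<phi> ** mat2 \<alpha> \<beta> 0 \<delta> = mat2 \<alpha> \<beta> 0 \<delta> ** M')" .
  have "\<pi> (free_gen 1) \<in> carrier G" using \<pi>(1) free_gen_closed by (rule hom_in_carrier)
  then have "\<pi> (free_gen 1) [^]\<^bsub>G\<^esub> int (order G) = \<one>\<^bsub>G\<^esub>"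
    using pow_order_eq_1 by (simp add: int_pow_int)
  then have "shear (int (order G)) \<in> Gamma_plus \<pi>"
    by (rule shear_in_Gamma_plus[OF assms(1) \<pi>(1)])
  moreover have "int (order G) \<noteq> 0" using assms(2) order_gt_0_iff_finite by simp
  moreover have "\<exists>M'. rho \<phi> ** mat2 \<alpha> \<beta> 0 \<delta> = mat2 \<alpha> \<beta> 0 \<delta> ** M'" if "\<phi> \<in> Gamma_plus \<pi>" for \<phi>
    using that by (intro lattice(4)[rule_format]) (simp_all add: Gamma_plus_def Aut_plus_def q_def)
  ultimately show ?thesis
    using infinite_abelianization_Gamma_plus[OF lattice(1-3)] by blast
qed

end
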